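(* Let $A_1\in\mathcal L(X)$, $B\in\mathcal L(\mathbb R^m,X)$ and $C\in\mathcal L(X,\mathbb R^p)$. The following statements are equivalent. (i) There exists a bounded linear operator $K_0\in\mathcal L(\mathbb R^p,\mathbb R^m)$ such that $A_1=BK_0C$. (ii) $\ker(C)\subseteq\ker(A_1)$ and $\operatorname{Ran}(A_1)\subseteq\operatorname{Ran}(B)$.
   Context: $X$ is a (real) Hilbert space and $m,p$ are positive integers. $\mathcal L(\cdot,\cdot)$ denotes bounded linear operators, and $\operatorname{Ran}$ denotes the range. *)

theory Defs
  imports "HOL-Analysis.Analysis"
begin

end

(* K0 is a linear right inverse of B on Ran(B), after A1, after a linear right inverse of C on Ran(C).
   It is bounded because its domain is finite-dimensional, so no continuity of the right inverses is needed. *)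
theory Submission imports Defs begin

theorem theorem2:
  fixes A1 :: "'x::{real_inner, complete_space} \<Rightarrow>\<^sub>L 'x"
    and B :: "(real ^ 'm) \<Rightarrow>\<^sub>L 'x"
    and C :: "'x \<Rightarrow>\<^sub>L (real ^ 'p)"
  shows "(\<exists>K0 :: (real ^ 'p) \<Rightarrow>\<^sub>L (real ^ 'm). A1 = B o\<^sub>L K0 o\<^sub>L C) \<longleftrightarrow>
    ({x. blinfun_apply C x = 0} \<subseteq> {x. blinfun_apply A1 x = 0} \<and>
     range (blinfun_apply A1) \<subseteq> range (blinfun_apply B))"
proof
  assume "\<exists>K0 :: (real ^ 'p) \<Rightarrow>\<^sub>L (real ^ 'm). A1 = B o\<^sub>L K0 o\<^sub>L C"
  then show "{x. blinfun_apply C x = 0} \<subseteq> {x. blinfun_apply A1 x = 0} \<and>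
     range (blinfun_apply A1) \<subseteq> range (blinfun_apply B)"
    by auto
next
  assume R: "{x. blinfun_apply C x = 0} \<subseteq> {x. blinfun_apply A1 x = 0} \<and>
     range (blinfun_apply A1) \<subseteq> range (blinfun_apply B)"
  have lin: "linear (blinfun_apply A1)" "linear (blinfun_apply B)" "linear (blinfun_apply C)"
    by (rule bounded_linear.linear[OF blinfun.bounded_linear_right])+
  \<comment> \<open>Choosing preimages of a basis of the range and extending linearly gives a map on
    the whole space; only its values on the range of \<open>B\<close> are prescribed.\<close>
  obtain g where g: "linear g" "\<And>v. v \<in> range B \<Longrightarrow> B (g v) = v"
    using linear_exists_right_inverse_on[OF lin(2) subspace_UNIV] by blast
  obtain h where h: "linear h" "\<And>v. v \<in> range C \<Longrightarrow> C (h v) = v"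
    using linear_exists_right_inverse_on[OF lin(3) subspace_UNIV] by blast
  have "linear (g \<circ> A1 \<circ> h)"
    by (intro linear_compose g(1) h(1) lin(1))
  \<comment> \<open>\<open>Blinfun\<close> is known to return its argument only for bounded linear
    maps; here linearity suffices, the domain being Euclidean.\<close>
  then have K: "blinfun_apply (Blinfun (g \<circ> A1 \<circ> h)) = g \<circ> A1 \<circ> h"
    by (intro bounded_linear_Blinfun_apply) (simp only: linear_conv_bounded_linear)
  have "B (g (A1 (h (C x)))) = A1 x" for x
  proof -
    \<comment> \<open>\<open>h (C x)\<close> may differ from \<open>x\<close>, but only by a vector
      of the kernel of \<open>C\<close>, which \<open>A1\<close> kills by the kernel
      inclusion.\<close>
    have "C (h (C x) - x) = 0"
      by (simp add: blinfun.diff_right h(2))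
    then have "A1 (h (C x) - x) = 0"
      using R by blast
    then have "A1 (h (C x)) = A1 x"
      by (simp add: blinfun.diff_right)
    \<comment> \<open>The range inclusion places \<open>A1 x\<close> where \<open>g\<close> does
      invert \<open>B\<close>.\<close>
    moreover have "A1 x \<in> range B"
      using R by blast
    ultimately show ?thesis
      by (simp add: g(2))
  qed
  then have "A1 = B o\<^sub>L Blinfun (g \<circ> A1 \<circ> h) o\<^sub>L C"
    by (intro blinfun_eqI) (simp add: K)
  then show "\<exists>K0 :: (real ^ 'p) \<Rightarrow>\<^sub>L (real ^ 'm). A1 = B o\<^sub>L K0 o\<^sub>L C" ..
qed

end
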